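(* Let $n\ge 2$, let $O$ be an interior point of a closed convex set $\mathcal C\subset\mathbb R^n$, and let the segment $[A^*B^*]$ (with $O\in[A^*B^*]$ and $A^*,B^*\in\partial\mathcal C$) be a local minimizer for $F$. Then: (i) There exists only one hyperplane $\Pi_1$ supporting $\mathcal C$ at $A^*$ and only one hyperplane $\Pi_2$ supporting $\mathcal C$ at $B^*$. (ii) The normal line to $\Pi_1$ at $A^*$ and the normal line to $\Pi_2$ at $B^*$ intersect at a point belonging to the hyperplane through $O$ which is orthogonal to the line $A^*B^*$.
   Context: $\partial\mathcal C$ is the boundary of $\mathcal C$; $|AB|$ is the Euclidean length of the segment $[AB]$. For a closed convex set $\mathcal C$ with interior point $O$, consider all segments $[AB]$ containing $O$ with end-points $A,B\in\partial\mathcal C$, and put $F([AB])=|AB|$. A segment $[A^*B^*]$ containing $O$, with end-points on $\partial\mathcal C$, is a local minimizer for $F$ if there are open sets $U\ni A^*$ and $V\ni B^*$ such that $|AB|\ge|A^*B^*|$ whenever $O\in[AB]$, $A\in\partial\mathcal C\cap U$ and $B\in\partial\mathcal C\cap V$. A hyperplane $\Pi$ supports $\mathcal C$ at $A\in\mathcal C$ if $A\in\Pi$ and $\mathcal C$ is contained in one of the two closed half-spaces determined by $\Pi$. "The normal lines intersect at a point belonging to a hyperplane" means that there is a point common to both normal lines and the hyperplane (the two normal lines are allowed to coincide). *)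

theory Defs
  imports "HOL-Analysis.Analysis"
begin

definition chord_through :: "'a::euclidean_space set \<Rightarrow> 'a \<Rightarrow> 'a \<Rightarrow> 'a \<Rightarrow> bool" where
  "chord_through C p A B \<longleftrightarrow>
     A \<in> frontier C \<and> B \<in> frontier C \<and> p \<in> closed_segment A B"

definition local_min_chord :: "'a::euclidean_space set \<Rightarrow> 'a \<Rightarrow> 'a \<Rightarrow> 'a \<Rightarrow> bool" where
  "local_min_chord C p A' B' \<longleftrightarrow>
     chord_through C p A' B' \<and>
     (\<exists>U V. open U \<and> open V \<and> A' \<in> U \<and> B' \<in> V \<and>
        (\<forall>A\<in>U. \<forall>B\<in>V. chord_through C p A B \<longrightarrow> dist A B \<ge> dist A' B'))"

definition supports_at :: "'a::euclidean_space set \<Rightarrow> 'a set \<Rightarrow> 'a \<Rightarrow> bool" where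
  "supports_at H C A \<longleftrightarrow>
     A \<in> C \<and> A \<in> H \<and>
     (\<exists>a b. a \<noteq> 0 \<and> H = {x. a \<bullet> x = b} \<and>
        (C \<subseteq> {x. a \<bullet> x \<le> b} \<or> C \<subseteq> {x. a \<bullet> x \<ge> b}))"

text \<open>Only meant for a hyperplane \<open>H\<close> containing \<open>A\<close>; the lemma below shows that
  it is then the line through \<open>A\<close> spanned by a normal vector of \<open>H\<close>.\<close>

definition normal_line :: "'a::euclidean_space set \<Rightarrow> 'a \<Rightarrow> 'a set" where
  "normal_line H A = {y. \<forall>x\<in>H. orthogonal (y - A) (x - A)}"

lemma normal_line_hyperplane:
  fixes a A :: "'a::euclidean_space"
  assumes "a \<noteq> 0" and "a \<bullet> A = b"
  shows "normal_line {x. a \<bullet> x = b} A = range (\<lambda>t. A + t *\<^sub>R a)"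
proof (intro equalityI subsetI)
  fix y assume y: "y \<in> normal_line {x. a \<bullet> x = b} A"
  define t where "t = (a \<bullet> (y - A)) / (a \<bullet> a)"
  define w where "w = y - A - t *\<^sub>R a"
  have aw: "a \<bullet> w = 0"
    using assms(1) by (simp add: w_def t_def inner_diff_right)
  then have "a \<bullet> (A + w) = b"
    using assms(2) by (simp add: inner_add_right)
  with y have "(y - A) \<bullet> w = 0"
    by (force simp: normal_line_def orthogonal_def)
  moreover have "y - A = w + t *\<^sub>R a"
    by (simp add: w_def)
  ultimately have "w \<bullet> w = 0"
    using aw by (simp add: inner_add_left)
  then have "w = 0"
    by (simp only: inner_eq_zero_iff)
  then have "y = A + t *\<^sub>R a"
    by (simp add: w_def algebra_simps)
  then show "y \<in> range (\<lambda>t. A + t *\<^sub>R a)"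
    by blast
next
  fix y assume "y \<in> range (\<lambda>t. A + t *\<^sub>R a)"
  then show "y \<in> normal_line {x. a \<bullet> x = b} A"
    using assms(2) by (auto simp: normal_line_def orthogonal_def inner_diff_right)
qed

end

theory Submission imports Defs begin

text \<open>
  Translate \<open>p\<close> to the origin and write a supporting hyperplane at a boundary point \<open>X\<close> as
  \<open>m \<bullet> x = 1\<close> with \<open>m \<bullet> x \<le> 1\<close> on \<open>C\<close>. Let \<open>m\<close>, \<open>n\<close> be such normals at \<open>B = d\<close> and \<open>A = -k d\<close>.
  The chord of direction \<open>v\<close> has length at most \<open>G v = \<bar>v\<bar> (1 / (m \<bullet> v) - 1 / (n \<bullet> v))\<close>, with
  equality at \<open>v = d\<close>, so the smooth function \<open>G\<close> has a local minimum at \<open>d\<close>. Its vanishing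
  gradient reads \<open>(1 + k) d = \<bar>d\<bar>\<^sup>2 (m - k\<^sup>2 n)\<close>. Each of \<open>m\<close>, \<open>n\<close> thus determines the other, which
  yields uniqueness, and \<open>d - \<bar>d\<bar>\<^sup>2 m = - k d - k\<^sup>2 \<bar>d\<bar>\<^sup>2 n\<close> is the required common point.
\<close>

section \<open>Supporting hyperplanes normalized with respect to an interior point\<close>

text \<open>A supporting hyperplane misses the interior point \<open>p\<close>, so its outer normal
  has exactly one multiple \<open>m\<close> taking the value 1 on it. Uniqueness of hyperplanes
  becomes uniqueness of these vectors, which are points of the polar of
  \<open>C - p\<close>.\<close>

definition unit_support :: "'a::euclidean_space set \<Rightarrow> 'a \<Rightarrow> 'a \<Rightarrow> 'a \<Rightarrow> bool" where
  "unit_support C p X m \<longleftrightarrow> m \<bullet> (X - p) = 1 \<and> (\<forall>x\<in>C. m \<bullet> (x - p) \<le> 1)"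

lemma supports_atE:
  fixes C :: "'a::euclidean_space set"
  assumes "supports_at H C X" and p: "p \<in> interior C"
  obtains m where "unit_support C p X m" and "H = {x. m \<bullet> (x - p) = 1}"
proof -
  from assms(1) obtain a0 b0 where "X \<in> H" "a0 \<noteq> 0" "H = {x. a0 \<bullet> x = b0}"
    "C \<subseteq> {x. a0 \<bullet> x \<le> b0} \<or> C \<subseteq> {x. a0 \<bullet> x \<ge> b0}"
    unfolding supports_at_def by blast
  \<comment> \<open>The sign of the normal is free, so the case \<ge> reduces to the case \<le>; the
    last fact is that implication written as a disjunction.\<close>
  moreover from this have "X \<in> H" "- a0 \<noteq> 0" "H = {x. (- a0) \<bullet> x = - b0}"
    "C \<subseteq> {x. (- a0) \<bullet> x \<le> - b0} \<or> \<not> C \<subseteq> {x. a0 \<bullet> x \<ge> b0}"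
    by auto
  ultimately obtain a b where X: "X \<in> H" and a: "a \<noteq> 0" and H: "H = {x. a \<bullet> x = b}"
    and C: "C \<subseteq> {x. a \<bullet> x \<le> b}"
    by blast
  have "p \<in> interior {x. a \<bullet> x \<le> b}"
    using p interior_mono[OF C] by blast
  then have gap: "0 < b - a \<bullet> p"
    using a by (simp add: interior_halfspace_le)
  define m where "m = a /\<^sub>R (b - a \<bullet> p)"
  have m: "m \<bullet> (x - p) = (a \<bullet> x - a \<bullet> p) / (b - a \<bullet> p)" for x
    by (simp add: m_def inner_diff_right divide_inverse algebra_simps)
  show thesis
  proof
    show "unit_support C p X m"
      using gap X C by (auto simp: unit_support_def m H)
    show "H = {x. m \<bullet> (x - p) = 1}"
      using gap by (auto simp: m H)
  qed
qed

text \<open>With nonempty interior, \<open>rel_interior C\<close> is the interior, so a frontier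
  point lies outside it and the separation theorem for the relative frontier applies.\<close>

lemma supports_at_exists:
  fixes C :: "'a::euclidean_space set"
  assumes "closed C" "convex C" "interior C \<noteq> {}" "X \<in> frontier C"
  shows "\<exists>H. supports_at H C X"
proof -
  have X: "X \<in> C" "X \<in> closure C" "X \<notin> rel_interior C"
    using assms rel_interior_nonempty_interior[of C] by (auto simp: frontier_def)
  obtain a where a: "a \<noteq> 0" "\<And>x. x \<in> closure C \<Longrightarrow> a \<bullet> X \<le> a \<bullet> x"
    using supporting_hyperplane_relative_frontier[OF assms(2) X(2,3)] by metis
  have "supports_at {x. a \<bullet> x = a \<bullet> X} C X"
    unfolding supports_at_def using a X(1) closure_subset by blast
  then show ?thesis ..
qed

section \<open>Frontier points on rays from the interior point\<close>

text \<open>For \<open>v\<close> near \<open>X - p\<close> the ray from \<open>p\<close> along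
  \<open>v\<close> is inside \<open>C\<close> just before parameter 1 and outside just after, so it
  meets the frontier near \<open>X\<close>. The supporting half-space bounds the parameter there by
  \<open>1 / (m \<bullet> v)\<close>.\<close>

lemma frontier_point_near:
  fixes C V :: "'a::euclidean_space set"
  assumes C: "closed C" "convex C" "p \<in> interior C" and X: "X \<in> frontier C"
    and m: "unit_support C p X m" and V: "open V" "X \<in> V"
  shows "\<forall>\<^sub>F v in nhds (X - p). \<exists>t>0. m \<bullet> v > 0 \<and> t \<le> 1 / (m \<bullet> v) \<and>
           p + t *\<^sub>R v \<in> frontier C \<inter> V"
proof -
  let ?d = "X - p"
  have "((\<lambda>z. p + fst z *\<^sub>R snd z) \<longlongrightarrow> p + 1 *\<^sub>R ?d) (nhds 1 \<times>\<^sub>F nhds ?d)"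
    by (intro tendsto_intros filterlim_fst filterlim_snd)
  then have "\<forall>\<^sub>F z in nhds 1 \<times>\<^sub>F nhds ?d. p + fst z *\<^sub>R snd z \<in> V"
    using V by (simp add: topological_tendstoD)
  then obtain P Q where P: "eventually P (nhds (1::real))" and Q: "eventually Q (nhds ?d)"
    and PQ: "\<And>t v. P t \<Longrightarrow> Q v \<Longrightarrow> p + t *\<^sub>R v \<in> V"
    unfolding eventually_prod_filter by auto
  from P obtain e where e: "e > 0" "\<And>t. dist t 1 < e \<Longrightarrow> P t"
    unfolding eventually_nhds_metric by blast
  \<comment> \<open>\<open>r < e\<close> keeps the frontier point in \<open>V\<close>, and
    \<open>r < 1\<close> keeps its parameter positive.\<close>
  define r where "r = min e 1 / 2"
  have r: "0 < r" "r < e" "r < 1"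
    using e(1) by (auto simp: r_def)
  have "X \<in> closure C"
    using X by (simp add: frontier_def)
  then have "X - r *\<^sub>R (X - p) \<in> interior C"
    using mem_interior_closure_convex_shrink[OF C(2,3)] r by simp
  then have "p + (1 - r) *\<^sub>R ?d \<in> interior C"
    by (simp add: algebra_simps)
  moreover have "((\<lambda>v. p + (1 - r) *\<^sub>R v) \<longlongrightarrow> p + (1 - r) *\<^sub>R ?d) (nhds ?d)"
    by (intro tendsto_intros filterlim_ident)
  ultimately have inner: "\<forall>\<^sub>F v in nhds ?d. p + (1 - r) *\<^sub>R v \<in> interior C"
    using topological_tendstoD open_interior by blast
  \<comment> \<open>Since \<open>m\<close> is 1 on \<open>X - p\<close>, the point at parameter
    \<open>1 + r\<close> is strictly beyond the hyperplane, and stays so for nearby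
    \<open>v\<close>.\<close>
  have "((\<lambda>v. (1 + r) * (m \<bullet> v)) \<longlongrightarrow> (1 + r) * (m \<bullet> ?d)) (nhds ?d)"
    by (intro tendsto_intros filterlim_ident)
  moreover have "1 < (1 + r) * (m \<bullet> ?d)"
    using m r by (simp add: unit_support_def)
  ultimately have outer: "\<forall>\<^sub>F v in nhds ?d. 1 < (1 + r) * (m \<bullet> v)"
    by (rule order_tendstoD)
  from Q inner outer show ?thesis
  proof eventually_elim
    case (elim v)
    have mv: "m \<bullet> v > 0"
      using elim(3) r by (smt (verit) mult_nonneg_nonpos)
    let ?S = "(\<lambda>t. p + t *\<^sub>R v) ` {1 - r..1 + r}"
    have "connected ?S"
      by (intro connected_continuous_image continuous_intros) simp
    moreover have "p + (1 - r) *\<^sub>R v \<in> ?S \<inter> C"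
      using r elim(2) interior_subset by auto
    moreover have "p + (1 + r) *\<^sub>R v \<notin> C"
      using elim(3) m by (force simp: unit_support_def)
    then have "p + (1 + r) *\<^sub>R v \<in> ?S - C"
      using r by auto
    ultimately have "?S \<inter> frontier C \<noteq> {}"
      by (intro connected_Int_frontier) auto
    then obtain t where t: "1 - r \<le> t" "t \<le> 1 + r" "p + t *\<^sub>R v \<in> frontier C"
      by auto
    then have "p + t *\<^sub>R v \<in> C"
      using C(1) frontier_subset_closed by blast
    then have "m \<bullet> (p + t *\<^sub>R v - p) \<le> 1"
      using m unfolding unit_support_def by blast
    then have "t \<le> 1 / (m \<bullet> v)"
      using mv by (simp add: field_simps)
    moreover have "p + t *\<^sub>R v \<in> V"
      using t r by (intro PQ e(2) elim(1)) (auto simp: dist_real_def)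
    ultimately show ?case
      using t r mv by (intro exI[of _ t]) auto
  qed
qed

text \<open>The ends are frontier points, hence differ from the interior point \<open>p\<close>. So
  \<open>p\<close> divides the chord properly, and \<open>k\<close> is the ratio of the two
  parts.\<close>

lemma chord_through_opposite:
  fixes C :: "'a::euclidean_space set"
  assumes "chord_through C p A B" "p \<in> interior C"
  obtains k where "k > 0" "A - p = - k *\<^sub>R (B - p)"
proof -
  have "A \<noteq> p" "B \<noteq> p"
    using assms by (auto simp: chord_through_def frontier_def)
  from assms obtain u where u: "0 \<le> u" "u \<le> 1" "p = (1 - u) *\<^sub>R A + u *\<^sub>R B"
    unfolding chord_through_def closed_segment_def by blast
  with \<open>A \<noteq> p\<close> \<open>B \<noteq> p\<close> have u01: "0 < u" "u < 1"
    by (auto simp: less_le)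
  have "(1 - u) *\<^sub>R (A - p) = - u *\<^sub>R (B - p)"
    using u(3) by (simp add: algebra_simps)
  then have "(1 / (1 - u)) *\<^sub>R ((1 - u) *\<^sub>R (A - p)) = (1 / (1 - u)) *\<^sub>R (- u *\<^sub>R (B - p))"
    by simp
  then have "A - p = - (u / (1 - u)) *\<^sub>R (B - p)"
    using u01 by simp
  then show thesis
    using u01 by (intro that[of "u / (1 - u)"]) auto
qed

section \<open>The first-order condition for a shortest chord\<close>

text \<open>At a local minimum every directional derivative of the smooth bound vanishes; the
  equation is this condition multiplied by \<open>norm d\<close>.\<close>

lemma chord_bound_critical:
  fixes d m n :: "'a::euclidean_space"
  assumes md: "m \<bullet> d = 1" and nd: "n \<bullet> d = - 1 / k" and k: "k > 0"
    and min: "\<forall>\<^sub>F v in nhds d. norm d * (1 / (m \<bullet> d) - 1 / (n \<bullet> d))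
                \<le> norm v * (1 / (m \<bullet> v) - 1 / (n \<bullet> v))"
  shows "(1 + k) *\<^sub>R d = (norm d)\<^sup>2 *\<^sub>R (m - k\<^sup>2 *\<^sub>R n)"
proof -
  have "d \<noteq> 0"
    using md by auto
  define G where "G v = norm v * (1 / (m \<bullet> v) - 1 / (n \<bullet> v))" for v
  have Gmin: "\<forall>\<^sub>F v in nhds d. G d \<le> G v"
    using min by (simp add: G_def)
  have crit: "((1 + k) *\<^sub>R d - (norm d)\<^sup>2 *\<^sub>R (m - k\<^sup>2 *\<^sub>R n)) \<bullet> w = 0" for w
  proof -
    define g where "g x = G (d + x *\<^sub>R w)" for x :: real
    \<comment> \<open>Product rule at \<open>d\<close>: the bracket has value \<open>1 + k\<close>,
      and its derivative is \<open>k\<^sup>2 * (n \<bullet> w) - m \<bullet> w\<close> because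
      \<open>(n \<bullet> d)\<^sup>2 = 1 / k\<^sup>2\<close>.\<close>
    define D where "D = (d \<bullet> w) / norm d * (1 + k) + norm d * (k\<^sup>2 * (n \<bullet> w) - m \<bullet> w)"
    have norm_deriv: "((\<lambda>x. norm (d + x *\<^sub>R w)) has_real_derivative (d \<bullet> w) / norm d) (at 0)"
    proof -
      have "((\<lambda>x. sqrt ((d + x *\<^sub>R w) \<bullet> (d + x *\<^sub>R w))) has_real_derivative
              (2 * (d \<bullet> w)) * (inverse (sqrt (d \<bullet> d)) / 2)) (at 0)"
        unfolding inner_add_left inner_add_right inner_scaleR_left inner_scaleR_right
        using \<open>d \<noteq> 0\<close> by (auto intro!: derivative_eq_intros simp: inner_commute leD[OF inner_ge_zero])
      then show ?thesis
        unfolding norm_eq_sqrt_inner[symmetric] by (simp add: field_simps)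
    qed
    have inv_m: "((\<lambda>x. 1 / (m \<bullet> d + x * (m \<bullet> w))) has_real_derivative - (m \<bullet> w)) (at 0)"
      unfolding md by (auto intro!: derivative_eq_intros)
    have "((\<lambda>x. 1 / (n \<bullet> d + x * (n \<bullet> w))) has_real_derivative - (n \<bullet> w) / (- 1 / k)\<^sup>2) (at 0)"
      unfolding nd using k by (auto intro!: derivative_eq_intros simp: power2_eq_square)
    then have inv_n: "((\<lambda>x. 1 / (n \<bullet> d + x * (n \<bullet> w))) has_real_derivative - (k\<^sup>2 * (n \<bullet> w))) (at 0)"
      by (simp add: power_divide mult.commute)
    have "(g has_real_derivative D) (at 0)"
      using DERIV_mult[OF norm_deriv DERIV_diff[OF inv_m inv_n]] k
      unfolding g_def G_def D_def inner_add_right inner_scaleR_right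
      by (simp add: md nd algebra_simps)
    moreover have "((\<lambda>x. d + x *\<^sub>R w) \<longlongrightarrow> d + 0 *\<^sub>R w) (nhds 0)"
      by (intro tendsto_intros filterlim_ident)
    then have "filterlim (\<lambda>x. d + x *\<^sub>R w) (nhds d) (nhds 0)"
      by simp
    from eventually_compose_filterlim[OF Gmin this]
    have "\<forall>\<^sub>F x in nhds 0. g 0 \<le> g x"
      by (simp add: g_def)
    then obtain e where "e > 0" "\<And>x. dist x 0 < e \<Longrightarrow> g 0 \<le> g x"
      unfolding eventually_nhds_metric by blast
    ultimately have "D = 0"
      by (intro DERIV_local_min[of g D 0 e]) (auto simp: dist_real_def)
    then have "norm d * D = 0"
      by simp
    then have "(1 + k) * (d \<bullet> w) + (norm d)\<^sup>2 * (k\<^sup>2 * (n \<bullet> w) - m \<bullet> w) = 0"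
      using \<open>d \<noteq> 0\<close> by (simp add: D_def distrib_left power2_eq_square mult.commute mult.left_commute)
    then show ?thesis
      by (simp add: inner_diff_left inner_add_left algebra_simps)
  qed
  \<comment> \<open>A vector orthogonal to every \<open>w\<close>, in particular to itself, is
    zero.\<close>
  show ?thesis
    using crit[of "(1 + k) *\<^sub>R d - (norm d)\<^sup>2 *\<^sub>R (m - k\<^sup>2 *\<^sub>R n)"]
    by simp
qed

text \<open>Each direction \<open>v\<close> near \<open>B - p\<close> has a true chord with ends in
  \<open>U\<close> and \<open>V\<close>, of length at most \<open>G v\<close>. As \<open>G\<close>
  is exact at \<open>B - p\<close>, minimality of the chord passes to \<open>G\<close>.\<close>

lemma local_min_chord_normals:
  fixes C :: "'a::euclidean_space set"
  assumes C: "closed C" "convex C" "p \<in> interior C" and min: "local_min_chord C p A B"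
    and n: "unit_support C p A n" and m: "unit_support C p B m"
    and k: "k > 0" "A - p = - k *\<^sub>R (B - p)"
  shows "(1 + k) *\<^sub>R (B - p) = (norm (B - p))\<^sup>2 *\<^sub>R (m - k\<^sup>2 *\<^sub>R n)"
proof -
  let ?d = "B - p"
  from min obtain U V where AB: "A \<in> frontier C" "B \<in> frontier C"
    and UV: "open U" "open V" "A \<in> U" "B \<in> V"
    and le: "\<And>A' B'. A' \<in> U \<Longrightarrow> B' \<in> V \<Longrightarrow> chord_through C p A' B' \<Longrightarrow> dist A B \<le> dist A' B'"
    unfolding local_min_chord_def chord_through_def by blast
  have md: "m \<bullet> ?d = 1"
    using m by (simp add: unit_support_def)
  then have d: "?d \<noteq> 0"
    by auto
  have nd: "n \<bullet> ?d = - 1 / k"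
  proof -
    have "n \<bullet> (- k *\<^sub>R ?d) = 1"
      using n k(2) by (simp add: unit_support_def)
    then have "k * (n \<bullet> ?d) = - 1"
      unfolding inner_scaleR_right by simp
    then show ?thesis
      using k(1) by (metis less_irrefl nonzero_mult_div_cancel_left)
  qed
  have distp: "dist (p - s *\<^sub>R v) (p + t *\<^sub>R v) = (t + s) * norm v" if "s > 0" "t > 0" for s t v
  proof -
    have "dist (p - s *\<^sub>R v) (p + t *\<^sub>R v) = norm (- (t + s) *\<^sub>R v)"
      unfolding dist_norm by (simp add: algebra_simps)
    then show ?thesis
      using that by simp
  qed
  define G where "G v = norm v * (1 / (m \<bullet> v) - 1 / (n \<bullet> v))" for v
  have Gd: "G ?d = dist A B"
  proof -
    have "A = p - k *\<^sub>R ?d" "B = p + 1 *\<^sub>R ?d"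
      using k by (simp_all add: algebra_simps)
    then have "dist A B = (1 + k) * norm ?d"
      using distp[of k 1 ?d] k(1) by simp
    then show ?thesis
      using k by (simp add: G_def md nd)
  qed
  have "((\<lambda>v. - k *\<^sub>R v) \<longlongrightarrow> - k *\<^sub>R ?d) (nhds ?d)"
    by (intro tendsto_intros filterlim_ident)
  then have lim: "filterlim (\<lambda>v. - k *\<^sub>R v) (nhds (A - p)) (nhds ?d)"
    by (simp add: k)
  \<comment> \<open>The ray lemma is used at \<open>B\<close> with direction \<open>v\<close> and at
    \<open>A\<close> with \<open>- k *\<^sub>R v\<close>, which tends to
    \<open>A - p\<close>.\<close>
  have Gmin: "\<forall>\<^sub>F v in nhds ?d. G ?d \<le> G v"
    using frontier_point_near[OF C AB(2) m UV(2,4)]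
      eventually_compose_filterlim[OF frontier_point_near[OF C AB(1) n UV(1,3)] lim]
  proof eventually_elim
    case (elim v)
    from elim obtain t s where t: "t > 0" "m \<bullet> v > 0" "t \<le> 1 / (m \<bullet> v)"
        "p + t *\<^sub>R v \<in> frontier C \<inter> V"
      and s: "s > 0" "n \<bullet> (- k *\<^sub>R v) > 0" "s \<le> 1 / (n \<bullet> (- k *\<^sub>R v))"
        "p + s *\<^sub>R (- k *\<^sub>R v) \<in> frontier C \<inter> U"
      by blast
    have nv: "n \<bullet> v < 0"
      using s(2) k(1) by (simp add: mult_less_0_iff)
    have sk: "s * k \<le> - 1 / (n \<bullet> v)"
      using mult_right_mono[OF s(3), of k] k(1) by simp
    have "p \<in> closed_segment (p - (s * k) *\<^sub>R v) (p + t *\<^sub>R v)"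
    proof -
      have pos: "t + s * k > 0"
        using t s k by (simp add: add_pos_pos)
      \<comment> \<open>The weight at which the multiples of \<open>v\<close> cancel, leaving
        \<open>p\<close>.\<close>
      define c where "c = (s * k) / (t + s * k)"
      have c: "c * (t + s * k) = s * k" "0 \<le> c" "c \<le> 1"
        using pos t s k by (auto simp: c_def)
      have "(1 - c) *\<^sub>R (p - (s * k) *\<^sub>R v) + c *\<^sub>R (p + t *\<^sub>R v)
          = p + (c * (t + s * k) - s * k) *\<^sub>R v"
        by (simp add: algebra_simps)
      then show ?thesis
        unfolding closed_segment_def using c by force
    qed
    then have "dist A B \<le> dist (p - (s * k) *\<^sub>R v) (p + t *\<^sub>R v)"
      using s(4) t(4) by (intro le) (auto simp: chord_through_def)
    also have "\<dots> = (t + s * k) * norm v"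
      using s t k by (intro distp) auto
    also have "\<dots> \<le> (1 / (m \<bullet> v) - 1 / (n \<bullet> v)) * norm v"
      using t sk by (intro mult_right_mono) auto
    also have "\<dots> = G v"
      by (simp add: G_def)
    finally show ?case
      by (simp add: Gd)
  qed
  show ?thesis
    using chord_bound_critical[OF md nd k(1)] Gmin unfolding G_def by blast
qed

section \<open>Uniqueness of the hyperplanes and the common point of the normals\<close>

lemma normal_line_unit_support:
  assumes "unit_support C p X m"
  shows "X + t *\<^sub>R m \<in> normal_line {x. m \<bullet> (x - p) = 1} X"
proof -
  have "m \<noteq> 0" "m \<bullet> X = 1 + m \<bullet> p"
    using assms by (auto simp: unit_support_def inner_diff_right)
  moreover have "{x. m \<bullet> (x - p) = 1} = {x. m \<bullet> x = 1 + m \<bullet> p}"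
    by (auto simp: inner_diff_right)
  ultimately show ?thesis
    by (simp add: normal_line_hyperplane)
qed

theorem theorem21:
  fixes C :: "(real ^ 'n) set" and p A B :: "real ^ 'n"
  assumes "CARD('n) \<ge> 2"
    and "closed C" and "convex C" and "p \<in> interior C"
    and "local_min_chord C p A B"
  shows "(\<exists>!H. supports_at H C A) \<and> (\<exists>!H. supports_at H C B) \<and>
    (\<forall>H1 H2. supports_at H1 C A \<and> supports_at H2 C B \<longrightarrow>
      normal_line H1 A \<inter> normal_line H2 B \<inter> {x. orthogonal (x - p) (B - A)} \<noteq> {})"
proof -
  note C = assms(2-4)
  have chord: "chord_through C p A B"
    using assms(5) by (simp add: local_min_chord_def)
  then have AB: "A \<in> frontier C" "B \<in> frontier C"
    by (simp_all add: chord_through_def)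
  obtain k where k: "k > 0" "A - p = - k *\<^sub>R (B - p)"
    using chord_through_opposite[OF chord C(3)] .
  define d where "d = B - p"
  have key: "(1 + k) *\<^sub>R d = (norm d)\<^sup>2 *\<^sub>R (m - k\<^sup>2 *\<^sub>R n)"
    if "unit_support C p A n" "unit_support C p B m" for m n
    using local_min_chord_normals[OF C assms(5) that k] by (simp add: d_def)
  have d: "d \<noteq> 0"
    using AB(2) C(3) by (auto simp: d_def frontier_def)
  obtain HA HB where HA: "supports_at HA C A" and HB: "supports_at HB C B"
    using supports_at_exists[OF C(1,2)] C(3) AB by blast
  from HA obtain n where n: "unit_support C p A n" "HA = {x. n \<bullet> (x - p) = 1}"
    by (rule supports_atE[OF _ C(3)])
  from HB obtain m where m: "unit_support C p B m" "HB = {x. m \<bullet> (x - p) = 1}"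
    by (rule supports_atE[OF _ C(3)])
  \<comment> \<open>With \<open>m\<close> fixed, \<open>key\<close> for \<open>n\<close> and
    \<open>n'\<close> gives equal right sides; the nonzero factor
    \<open>(norm d)\<^sup>2 * k\<^sup>2\<close> cancels.\<close>
  have uA: "H = HA" if H: "supports_at H C A" for H
  proof -
    from H obtain n' where n': "unit_support C p A n'" "H = {x. n' \<bullet> (x - p) = 1}"
      by (rule supports_atE[OF _ C(3)])
    have "n' = n"
      using key[OF n'(1) m(1)] key[OF n(1) m(1)] d k by simp
    then show ?thesis
      using n n' by simp
  qed
  have uB: "H = HB" if H: "supports_at H C B" for H
  proof -
    from H obtain m' where m': "unit_support C p B m'" "H = {x. m' \<bullet> (x - p) = 1}"
      by (rule supports_atE[OF _ C(3)])
    have "m' = m"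
      using key[OF n(1) m'(1)] key[OF n(1) m(1)] d by simp
    then show ?thesis
      using m m' by simp
  qed
  \<comment> \<open>As \<open>m \<bullet> d = 1\<close>, this is the point of the normal line at
    \<open>B\<close> with \<open>z - p\<close> orthogonal to \<open>d\<close>; \<open>key\<close>
    puts it on the normal line at \<open>A\<close> too.\<close>
  define z where "z = B + (- (norm d)\<^sup>2) *\<^sub>R m"
  have A: "A = p - k *\<^sub>R d" and B: "B = p + d"
    using k(2) by (simp_all add: d_def algebra_simps)
  have "z = A + (- (norm d)\<^sup>2 * k\<^sup>2) *\<^sub>R n"
    using key[OF n(1) m(1)] unfolding z_def A B by (simp add: algebra_simps)
  then have "z \<in> normal_line HA A"
    using normal_line_unit_support[OF n(1)] n(2) by metis
  moreover have "z \<in> normal_line HB B"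
    using normal_line_unit_support[OF m(1)] m(2) z_def by metis
  moreover have "orthogonal (z - p) (B - A)"
  proof -
    have "z - p = d - (norm d)\<^sup>2 *\<^sub>R m" "B - A = (1 + k) *\<^sub>R d"
      by (simp_all add: z_def A B algebra_simps)
    moreover have "m \<bullet> d = 1"
      using m(1) by (simp add: unit_support_def d_def)
    ultimately show ?thesis
      by (simp add: orthogonal_def inner_diff_left power2_norm_eq_inner)
  qed
  ultimately have "z \<in> normal_line HA A \<inter> normal_line HB B \<inter> {x. orthogonal (x - p) (B - A)}"
    by simp
  then show ?thesis
    using HA HB uA uB by blast
qed

end
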